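(* Let $X=\{x_1,x_2,\ldots,x_s\}$ be a finite alphabet, let $V\subseteq\mathbb{R}^n$ be a vector space (a subspace of $\mathbb{R}^n$), and let $\mathcal{A}=(S,\sigma,\{\delta_x\}_{x\in X},\Theta)$ be a finite weighted automaton over the vector space $V$, with $S=\{\alpha_1,\alpha_2,\ldots,\alpha_m\}$. Let $N$ be the state matrix, $N_{x_1},\ldots,N_{x_s}$ the destination matrices, and $\vartheta$ the terminal vector of $\mathcal{A}$. Then $\mathcal{A}$ is linear if and only if the matrix $N$ has the same rank as the augmented matrix \[ [\,N\mid N_{x_1}\mid N_{x_2}\mid\ldots\mid N_{x_s}\mid\vartheta\,]. \]
   Context: A weighted automaton over a real vector space $V$ with alphabet $X$ is a tuple $\mathcal{A}=(S,\sigma,\{\delta_x\}_{x\in X},\Theta)$, where $S\subseteq V$ is a non-empty set of vectors (the vector states), $\sigma\in S$ is the initial vector state, $\delta_x:S\to S$ for $x\in X$ are the transition functions, and $\Theta:S\to\mathbb{R}$ is the terminal weights function. It is called finite if $S$ is finite. $\mathcal{A}$ is linear if for every $x\in X$ the function $\delta_x$ is the restriction to $S$ of some linear operator $\delta_x':\mathrm{span}(S)\to\mathrm{span}(S)$, and $\Theta$ is the restriction to $S$ of some linear functional $\Theta':\mathrm{span}(S)\to\mathbb{R}$. For $S=\{\alpha_1,\ldots,\alpha_m\}\subseteq\mathbb{R}^n$ and $X=\{x_1,\ldots,x_s\}$, with vectors of $\mathbb{R}^n$ written as rows: the state matrix $N\in\mathbb{R}^{m\times n}$ has rows $\alpha_1,\ldots,\alpha_m$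 (in this order); for each $i\in\{1,\ldots,s\}$ the destination matrix $N_{x_i}\in\mathbb{R}^{m\times n}$ has rows $\delta_{x_i}(\alpha_1),\ldots,\delta_{x_i}(\alpha_m)$ (in this order); the terminal vector $\vartheta$ is the column vector of length $m$ with entries $\Theta(\alpha_1),\ldots,\Theta(\alpha_m)$ (in this order). The augmented matrix $[\,M_1\mid\ldots\mid M_k\,]$ is obtained by concatenating the matrices $M_1,\ldots,M_k$ (all with $m$ rows) from left to right. *)

theory Defs
  imports "HOL-Analysis.Analysis"
begin

text \<open>The functions \<open>delta\<close> and \<open>Theta\<close> are total in HOL; only their values on the vector
  states (and, for \<open>delta\<close>, at letters of the alphabet) are meaningful, and only these values
  are used below.\<close>

record ('x, 'v) weighted_automaton =
  states :: "'v set"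
  initial :: 'v
  delta :: "'x \<Rightarrow> 'v \<Rightarrow> 'v"
  Theta :: "'v \<Rightarrow> real"

definition weighted_automaton_over ::
    "'v::real_vector set \<Rightarrow> 'x set \<Rightarrow> ('x, 'v) weighted_automaton \<Rightarrow> bool" where
  "weighted_automaton_over V X A \<longleftrightarrow>
     subspace V \<and> states A \<subseteq> V \<and> states A \<noteq> {} \<and> initial A \<in> states A \<and>
     (\<forall>x\<in>X. delta A x ` states A \<subseteq> states A)"

definition finite_automaton :: "('x, 'v) weighted_automaton \<Rightarrow> bool" where
  "finite_automaton A \<longleftrightarrow> finite (states A)"

text \<open>The library's \<^term>\<open>linear\<close> speaks of maps defined on a whole type; here the domain is a
  subspace \<open>U\<close>.\<close>

definition linear_map_on ::
    "'v::real_vector set \<Rightarrow> ('v \<Rightarrow> 'w::real_vector) \<Rightarrow> bool" where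
  "linear_map_on U f \<longleftrightarrow>
     (\<forall>u\<in>U. \<forall>v\<in>U. f (u + v) = f u + f v) \<and> (\<forall>c. \<forall>u\<in>U. f (c *\<^sub>R u) = c *\<^sub>R f u)"

definition linear_automaton ::
    "'x set \<Rightarrow> ('x, 'v::real_vector) weighted_automaton \<Rightarrow> bool" where
  "linear_automaton X A \<longleftrightarrow>
     (\<forall>x\<in>X. \<exists>D. D ` span (states A) \<subseteq> span (states A) \<and> linear_map_on (span (states A)) D \<and>
                (\<forall>\<alpha>\<in>states A. D \<alpha> = delta A x \<alpha>)) \<and>
     (\<exists>T. linear_map_on (span (states A)) T \<and> (\<forall>\<alpha>\<in>states A. T \<alpha> = Theta A \<alpha>))"

text \<open>In what follows \<open>\<alpha> :: 'm \<Rightarrow> real^'n\<close> enumerates the vector states,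
  so the matrices are \<open>m \<times> n\<close> with \<open>m = CARD('m)\<close> and \<open>n = CARD('n)\<close>.\<close>

definition state_matrix :: "('m \<Rightarrow> real^'n) \<Rightarrow> real^'n^'m" where
  "state_matrix \<alpha> = (\<chi> k. \<alpha> k)"

definition destination_matrix ::
    "('x, real^'n) weighted_automaton \<Rightarrow> ('m \<Rightarrow> real^'n) \<Rightarrow> 'x \<Rightarrow> real^'n^'m" where
  "destination_matrix A \<alpha> x = (\<chi> k. delta A x (\<alpha> k))"

definition terminal_vector ::
    "('x, real^'n) weighted_automaton \<Rightarrow> ('m \<Rightarrow> real^'n) \<Rightarrow> real^'m" where
  "terminal_vector A \<alpha> = (\<chi> k. Theta A (\<alpha> k))"

text \<open>Concatenation of blocks: the columns of the augmented matrix are indexed by the disjoint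
  union of the column index types of its blocks, where \<open>(i, j) :: 's \<times> 'n\<close> is column \<open>j\<close> of
  the block with number \<open>i\<close>.\<close>

definition augmented_matrix ::
    "real^'n^'m \<Rightarrow> ('s::finite \<Rightarrow> real^'n^'m) \<Rightarrow> real^'m \<Rightarrow> real^('n + 's \<times> 'n + unit)^'m" where
  "augmented_matrix N M v =
     (\<chi> k c. case c of
        Inl j \<Rightarrow> N $ k $ j
      | Inr (Inl (i, j)) \<Rightarrow> M i $ k $ j
      | Inr (Inr u) \<Rightarrow> v $ k)"

end

theory Submission
  imports Defs
begin

text \<open>A vector lies in the column space of the state matrix iff it lists the values of some linear
  functional at the vector states. So linearity of the automaton says that every column of the
  augmented matrix is in the column space of the state matrix, i.e. that both matrices have the
  same column space; as one column space contains the other, this is equality of ranks.\<close>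

text \<open>Values on a basis of \<open>span S\<close> chosen inside \<open>S\<close> extend
  linearly to the whole space, and two maps linear on \<open>span S\<close> that agree on such a
  basis agree on \<open>span S\<close>. This trades maps linear only on a subspace for maps
  satisfying \<open>linear\<close>.\<close>

lemma linear_map_on_span_extend:
  fixes f :: "'v::real_vector \<Rightarrow> 'w::real_vector"
  assumes f: "linear_map_on (span S) f"
  obtains g where "linear g" "\<And>v. v \<in> span S \<Longrightarrow> g v = f v"
proof -
  have add: "f (u + v) = f u + f v" if "u \<in> span S" "v \<in> span S" for u v
    using f that by (simp add: linear_map_on_def)
  have scale: "f (c *\<^sub>R u) = c *\<^sub>R f u" if "u \<in> span S" for c u
    using f that by (simp add: linear_map_on_def)
  obtain B where B: "B \<subseteq> S" "independent B" "S \<subseteq> span B"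
    by (rule maximal_independent_subset)
  have span: "span B = span S"
    using B by (metis span_mono span_span subset_antisym)
  obtain g where g: "linear g" "\<forall>b\<in>B. g b = f b"
    using linear_independent_extend[OF B(2)] by blast
  \<comment> \<open>Membership in \<open>span S\<close> is carried through the induction because
    \<open>f\<close> is known to be additive and homogeneous only there.\<close>
  have "v \<in> span S \<and> g v = f v" if "v \<in> span B" for v
    using that
  proof (induction rule: span_induct_alt)
    case base
    \<comment> \<open>\<open>f 0 = 0\<close> comes from homogeneity with the scalar 0.\<close>
    show ?case
      using scale[OF span_zero, of 0] by (simp add: span_zero linear_0[OF g(1)])
  next
    case (step c b v)
    have "b \<in> span S"
      using step(1) B(1) by (auto intro: span_base)
    then show ?case
      using step g by (simp add: add scale span_add span_scale linear_add linear_scale)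
  qed
  with g(1) span that show thesis by blast
qed

lemma linear_imp_linear_map_on: "linear f \<Longrightarrow> linear_map_on U f"
  by (simp add: linear_map_on_def linear_add linear_scale)

text \<open>Invariance of the span comes for free: an operator that agrees with
  \<open>delta A x\<close> sends vector states to vector states, hence the span of
  \<open>states A\<close> into itself. What remains is the existence of linear maps with prescribed
  values at the vector states.\<close>

lemma linear_automaton_iff:
  assumes "\<And>x. x \<in> X \<Longrightarrow> delta A x ` states A \<subseteq> states A"
  shows "linear_automaton X A \<longleftrightarrow>
    (\<forall>x\<in>X. \<exists>D. linear D \<and> (\<forall>s\<in>states A. D s = delta A x s)) \<and>
    (\<exists>T. linear T \<and> (\<forall>s\<in>states A. T s = Theta A s))"
proof -
  have D: "(\<exists>D. D ` span (states A) \<subseteq> span (states A) \<and> linear_map_on (span (states A)) D \<and>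
                (\<forall>s\<in>states A. D s = delta A x s)) \<longleftrightarrow>
        (\<exists>D. linear D \<and> (\<forall>s\<in>states A. D s = delta A x s))" (is "?l \<longleftrightarrow> ?r")
    if "x \<in> X" for x
  proof
    show ?r if ?l
      using that by (metis linear_map_on_span_extend span_base)
    show ?l if ?r
    proof -
      from that obtain D where D: "linear D" "\<forall>s\<in>states A. D s = delta A x s" by blast
      then have "D ` states A \<subseteq> states A"
        using assms[OF \<open>x \<in> X\<close>] by auto
      then have "D ` span (states A) \<subseteq> span (states A)"
        by (metis D(1) linear_span_image span_mono)
      with D show ?l
        using linear_imp_linear_map_on by blast
    qed
  qed
  have T: "(\<exists>T. linear_map_on (span (states A)) T \<and> (\<forall>s\<in>states A. T s = Theta A s)) \<longleftrightarrow>
        (\<exists>T. linear T \<and> (\<forall>s\<in>states A. T s = Theta A s))"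
    by (metis linear_imp_linear_map_on linear_map_on_span_extend span_base)
  show ?thesis
    unfolding linear_automaton_def T using D by (simp cong: ball_cong)
qed

text \<open>A map into \<open>real^'n\<close> is linear exactly when its coordinates are, so
  coordinate functionals can be chosen independently and reassembled. Each coordinate
  \<open>j\<close> will match one column of a destination matrix.\<close>

lemma linear_extension_vec_iff:
  fixes h :: "'a::real_vector \<Rightarrow> real^'n"
  shows "(\<exists>D. linear D \<and> (\<forall>s\<in>S. D s = h s)) \<longleftrightarrow>
    (\<forall>j. \<exists>f. linear f \<and> (\<forall>s\<in>S. f s = h s $ j))"
proof
  assume "\<exists>D. linear D \<and> (\<forall>s\<in>S. D s = h s)"
  then obtain D where D: "linear D" "\<forall>s\<in>S. D s = h s" by blast
  show "\<forall>j. \<exists>f. linear f \<and> (\<forall>s\<in>S. f s = h s $ j)"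
  proof
    fix j
    have "linear (\<lambda>s. D s $ j)"
      using D(1) by (simp add: linear_iff)
    with D(2) show "\<exists>f. linear f \<and> (\<forall>s\<in>S. f s = h s $ j)"
      by (intro exI[of _ "\<lambda>s. D s $ j"]) simp
  qed
next
  assume "\<forall>j. \<exists>f. linear f \<and> (\<forall>s\<in>S. f s = h s $ j)"
  then obtain f where f: "\<And>j. linear (f j)" "\<And>j s. s \<in> S \<Longrightarrow> f j s = h s $ j"
    by metis
  have "linear (\<lambda>s. \<chi> j. f j s)"
    using f(1) by (simp add: linear_iff vec_eq_iff)
  with f(2) show "\<exists>D. linear D \<and> (\<forall>s\<in>S. D s = h s)"
    by (intro exI[of _ "\<lambda>s. \<chi> j. f j s"]) (simp add: vec_eq_iff)
qed

lemma span_columns_eq_range: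
  fixes M :: "real^'n^'m"
  shows "span (columns M) = range ((*v) M)"
proof
  have "columns M \<subseteq> range ((*v) M)"
    by (auto simp: columns_image_basis)
  then show "span (columns M) \<subseteq> range ((*v) M)"
    by (intro span_minimal linear_subspace_image matrix_vector_mul_linear subspace_UNIV)
  show "range ((*v) M) \<subseteq> span (columns M)"
    using matrix_vector_mult_in_columnspace by blast
qed

text \<open>Multiplying the state matrix by \<open>w\<close> lists the inner products of
  \<open>w\<close> with the rows \<open>\<alpha> k\<close>, and every linear functional on
  \<open>real^'n\<close> is the inner product with a fixed vector.\<close>

lemma in_span_columns_state_matrix_iff:
  "v \<in> span (columns (state_matrix \<alpha>)) \<longleftrightarrow> (\<exists>f. linear f \<and> (\<forall>k. f (\<alpha> k) = v $ k))"
proof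
  assume "v \<in> span (columns (state_matrix \<alpha>))"
  then obtain w where "v = state_matrix \<alpha> *v w"
    by (auto simp: span_columns_eq_range)
  then have "w \<bullet> \<alpha> k = v $ k" for k
    by (simp add: state_matrix_def matrix_vector_mul_component inner_commute)
  moreover have "linear (\<lambda>u. w \<bullet> u)"
    by (simp add: bounded_linear.linear bounded_linear_inner_right)
  ultimately show "\<exists>f. linear f \<and> (\<forall>k. f (\<alpha> k) = v $ k)"
    by blast
next
  assume "\<exists>f. linear f \<and> (\<forall>k. f (\<alpha> k) = v $ k)"
  then obtain f where f: "linear f" "\<And>k. f (\<alpha> k) = v $ k" by blast
  \<comment> \<open>The vector representing \<open>f\<close> is the image of 1 under its
    adjoint.\<close>
  have "\<alpha> k \<bullet> adjoint f 1 = v $ k" for k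
    using adjoint_works[OF f(1), of "\<alpha> k" 1] f(2) by simp
  then have "v = state_matrix \<alpha> *v adjoint f 1"
    by (simp add: vec_eq_iff state_matrix_def matrix_vector_mul_component)
  then show "v \<in> span (columns (state_matrix \<alpha>))"
    by (simp add: span_columns_eq_range)
qed

text \<open>Only sets of columns matter for the rank, so the index bookkeeping of the concatenation
  is discarded here.\<close>

lemma columns_augmented_matrix:
  "columns (augmented_matrix N M v) = columns N \<union> (\<Union>i. columns (M i)) \<union> {v}"
proof -
  have "column (Inl j) (augmented_matrix N M v) = column j N"
    "column (Inr (Inl (i, j))) (augmented_matrix N M v) = column j (M i)"
    "column (Inr (Inr u)) (augmented_matrix N M v) = v" for i j u
    by (simp_all add: augmented_matrix_def column_def vec_eq_iff)
  then show ?thesis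
    by (auto simp: columns_def full_SetCompr_eq UNIV_sum UNIV_unit image_iff)
      (metis | force)+
qed

text \<open>The rank is the dimension of the column space, and a subspace of a finite-dimensional
  space that has the same dimension is the whole space.\<close>

lemma rank_eq_iff_columns_in_span:
  fixes N :: "real^'n^'m" and P :: "real^'p^'m"
  assumes "columns N \<subseteq> columns P"
  shows "rank N = rank P \<longleftrightarrow> columns P \<subseteq> span (columns N)"
  unfolding column_rank_def
proof
  assume "dim (columns N) = dim (columns P)"
  then have "span (columns N) = span (columns P)"
    using assms by (intro dim_eq_span) auto
  then show "columns P \<subseteq> span (columns N)"
    by (simp add: span_superset)
next
  assume "columns P \<subseteq> span (columns N)"
  then show "dim (columns N) = dim (columns P)"
    using assms by (metis dim_subset dim_span le_antisym)
qed

theorem theorem4p3: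
  fixes V :: "(real^'n) set"
    and X :: "'x set"
    and A :: "('x, real^'n) weighted_automaton"
    and x :: "'s::finite \<Rightarrow> 'x"
    and \<alpha> :: "'m::finite \<Rightarrow> real^'n"
  assumes "X = range x"
    and "weighted_automaton_over V X A"
    and "finite_automaton A"
    and "states A = range \<alpha>"
  shows "linear_automaton X A \<longleftrightarrow>
         rank (state_matrix \<alpha>) =
         rank (augmented_matrix (state_matrix \<alpha>)
                 (\<lambda>i. destination_matrix A \<alpha> (x i)) (terminal_vector A \<alpha>))"
proof -
  let ?N = "state_matrix \<alpha>"
  let ?M = "\<lambda>i. destination_matrix A \<alpha> (x i)"
  let ?v = "terminal_vector A \<alpha>"
  \<comment> \<open>Column \<open>j\<close> of the destination matrix lists the \<open>j\<close>-th
    coordinates of the successors under \<open>x i\<close>, so each column asks for one coordinate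
    functional.\<close>
  have dest: "(\<forall>j. column j (?M i) \<in> span (columns ?N)) \<longleftrightarrow>
      (\<exists>D. linear D \<and> (\<forall>s\<in>states A. D s = delta A (x i) s))" for i
    unfolding linear_extension_vec_iff
    by (simp add: in_span_columns_state_matrix_iff column_def destination_matrix_def assms(4))
  have terminal: "?v \<in> span (columns ?N) \<longleftrightarrow> (\<exists>T. linear T \<and> (\<forall>s\<in>states A. T s = Theta A s))"
    by (simp add: in_span_columns_state_matrix_iff terminal_vector_def assms(4))
  have "delta A y ` states A \<subseteq> states A" if "y \<in> X" for y
    using assms(2) that by (simp add: weighted_automaton_over_def)
  then have "linear_automaton X A \<longleftrightarrow>
      (\<forall>i j. column j (?M i) \<in> span (columns ?N)) \<and> ?v \<in> span (columns ?N)"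
    unfolding dest terminal by (simp add: linear_automaton_iff assms(1))
  \<comment> \<open>The block \<open>?N\<close> adds no condition, since its columns lie in their
    own span.\<close>
  also have "\<dots> \<longleftrightarrow> columns (augmented_matrix ?N ?M ?v) \<subseteq> span (columns ?N)"
    by (auto simp: columns_augmented_matrix span_base) (auto simp: columns_def)
  also have "\<dots> \<longleftrightarrow> rank ?N = rank (augmented_matrix ?N ?M ?v)"
    by (rule rank_eq_iff_columns_in_span[symmetric]) (auto simp: columns_augmented_matrix)
  finally show ?thesis .
qed

end
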